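(* The Lagrangian dual problem of the fluidly approximated master problem [SO/Master-A] (defined in the context) is given as the problem [SO/Master-D]: $$\max_{\mathbf p}\; G(\mathbf p)\equiv\sum_{j\in\mathcal J}N^S_j\,\Pi^S_j(\mathbf p)+\sum_{t\in\mathcal T}\sum_{w\in\mathcal W}N^D_{(t,w)}\,\Pi^D_{(t,w)}(\mathbf p).$$ This is an unconstrained optimization problem; its only decision variable is the price vector $\mathbf p=[p_{(t,j)}]_{j\in\mathcal J,t\in\mathcal T}$, which is the dual variable associated with the demand-supply constraints $y_{j,t}\le\sum_{w\in\mathcal W}\sum_{r\in\tilde{\mathcal R}}\delta_{r,j}f_{(t,w),r}$ ($j\in\mathcal J$, $t\in\mathcal T$) of [SO/Master-A].
   Context: Setting. $\mathcal J$ (task categories, i.e. pickup-delivery location pairs), $\mathcal W$ (driver origin-destination pairs), $\mathcal T=\{1,\dots,T\}$ (time windows) are finite sets; $\tilde{\mathcal T}=\mathcal T\cup\{0\}$, where $0$ is the shippers' opt-out. $\mathcal R$ is the finite set of task bundles, i.e. lists $r=[j_1,\dots,j_k]$ of elements of $\mathcal J$ with $k\le K$; $\tilde{\mathcal R}=\mathcal R\cup\{\emptyset\}$, where $\emptyset$ means performing no task; $\delta_{r,j}$ is the (nonnegative integer) number of tasks of category $j$ in $r$, with $\delta_{\emptyset,j}=0$. $N^S_j$ is the number of shippers of category $j$, and $N^D_{(t,w)}$ the number of drivers in group $(t,w)$; these numbers are assumed sufficiently large that the perceived costs of individual shippers and drivers can be approximated by the random costs $C^S_{j,t}-\zeta_{j,t}$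 ($t\in\tilde{\mathcal T}$) and $C^D_{(t,w),r}-\epsilon_{(t,w),r}$ ($r\in\tilde{\mathcal R}$). Here $C^S_{j,t}$ and $C^D_{(t,w),r}$ are deterministic costs, with vectors $\mathbf C^S_j$ and $\mathbf C^D_{(t,w)}$, and $\zeta_{j,t}$ and $\epsilon_{(t,w),r}$ are unobservable random utilities following joint distributions with finite means that are continuous and independent of the deterministic costs. Surplus (expected minimum cost) functions: $\Pi^S_j(\mathbf v)=\mathbb E[\min_{t\in\tilde{\mathcal T}}\{v_t-\zeta_{j,t}\}]$ for $\mathbf v\in\mathbb R^{\tilde{\mathcal T}}$, and $\Pi^D_{(t,w)}(\mathbf v)=\mathbb E[\min_{r\in\tilde{\mathcal R}}\{v_r-\epsilon_{(t,w),r}\}]$ for $\mathbf v\in\mathbb R^{\tilde{\mathcal R}}$. For a price vector $\mathbf p$, $\Pi^S_j(\mathbf p)$ means $\Pi^S_j(\mathbf v^S_j)$ with $v^S_{j,t}=C^S_{j,t}+p_{(t,j)}$ (where $p_{(0,j)}=0$: no fee for opting out), and $\Pi^D_{(t,w)}(\mathbf p)$ means $\Pi^D_{(t,w)}(\mathbf v^D_{(t,w)})$ with $v^D_{(t,w),r}=C^D_{(t,w),r}-\sum_{j\in\mathcal J}\delta_{r,j}p_{(t,j)}$. Perturbation functions (convex conjugates of the surplus functions): $\mathcal H^S_j(\mathbf P^S_j)=\inf_{\mathbf v}\{\mathbf v^\top\mathbf P^S_j-\Pi^S_j(\mathbf v)\}$ and $\mathcal H^D_{(t,w)}(\mathbf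 P^D_{(t,w)})=\inf_{\mathbf v}\{\mathbf v^\top\mathbf P^D_{(t,w)}-\Pi^D_{(t,w)}(\mathbf v)\}$, where $\mathbf P^S_j=[P^S_j(t)]_{t\in\tilde{\mathcal T}}$ and $\mathbf P^D_{(t,w)}=[P^D_{(t,w)}(r)]_{r\in\tilde{\mathcal R}}$ are probability distributions, interpreted as the task partition ratios $P^S_j(t)=y_{j,t}/N^S_j$ and $P^D_{(t,w)}(r)=f_{(t,w),r}/N^D_{(t,w)}$. Further, $\hat{\mathcal H}^S_j(\mathbf y_j)=N^S_j\,\mathcal H^S_j(\mathbf P^S_j)$ and $\hat{\mathcal H}^D_{(t,w)}(\mathbf f_{(t,w)})=N^D_{(t,w)}\,\mathcal H^D_{(t,w)}(\mathbf P^D_{(t,w)})$ with these ratios. Problem [SO/Master-A]: over continuous variables $\mathbf y=[y_{j,t}]_{j\in\mathcal J,t\in\tilde{\mathcal T}}$ (numbers of shipping permits) and $\mathbf f=[f_{(t,w),r}]_{(t,w)\in\mathcal T\times\mathcal W,r\in\tilde{\mathcal R}}$ (numbers of task bundles allocated to driver groups), minimize $$\sum_{j\in\mathcal J}\big(\mathbf C^S_j\cdot\mathbf y_j-\hat{\mathcal H}^S_j(\mathbf y_j)\big)+\sum_{t\in\mathcal T}\sum_{w\in\mathcal W}\big(\mathbf C^D_{(t,w)}\cdot\mathbf f_{(t,w)}-\hat{\mathcal H}^D_{(t,w)}(\mathbf f_{(t,w)})\big)$$ subject to $y_{j,t}\le\sum_{w\in\mathcal W}\sum_{r\in\tilde{\mathcal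 R}}\delta_{r,j}f_{(t,w),r}$ for all $j\in\mathcal J$, $t\in\mathcal T$; $\sum_{t\in\tilde{\mathcal T}}y_{j,t}=N^S_j$ for all $j\in\mathcal J$; and $\sum_{r\in\tilde{\mathcal R}}f_{(t,w),r}=N^D_{(t,w)}$ for all $(t,w)\in\mathcal T\times\mathcal W$.
   Formalization: Multipliers of "≤" constraints must be nonnegative, so the dual is max of G over p ≥ 0, not an unconstrained problem (the values can differ). Proved: the dual function equals G at every p, so the dual is max over p ≥ 0 of G, and with sign-free multipliers it is the unconstrained problem. *)

theory Defs
  imports "HOL-Probability.Probability"
begin

section \<open>Programs and Lagrangian duals\<close>

text \<open>
  A minimisation problem: minimise \<open>cost x\<close> over those \<open>x \<in> ground\<close> for which
  \<open>gap k x \<le> 0\<close> for all \<open>k \<in> relaxed\<close>.  Only the inequality constraints indexed by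
  \<open>relaxed\<close> are dualised; \<open>ground\<close> collects the constraints that are kept.
\<close>

record ('x, 'k) min_problem =
  ground :: "'x set"
  cost :: "'x \<Rightarrow> ereal"
  relaxed :: "'k set"
  gap :: "'k \<Rightarrow> 'x \<Rightarrow> real"

record 'p max_problem =
  feasible :: "'p set"
  payoff :: "'p \<Rightarrow> ereal"

definition lagrangian :: "('x, 'k) min_problem \<Rightarrow> 'x \<Rightarrow> ('k \<Rightarrow> real) \<Rightarrow> ereal" where
  "lagrangian A x p = cost A x + ereal (\<Sum>k\<in>relaxed A. p k * gap A k x)"

definition dual_function :: "('x, 'k) min_problem \<Rightarrow> ('k \<Rightarrow> real) \<Rightarrow> ereal" where
  "dual_function A p = (INF x\<in>ground A. lagrangian A x p)"

text \<open>
  The set \<open>\<Lambda>\<close> of admissible multipliers is a parameter: \<open>\<Lambda> = UNIV\<close> leaves the multipliers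
  free, \<open>\<Lambda> = nonneg_multipliers A\<close> is the textbook choice for inequality constraints.
  A multiplier vector is a total function whose values outside \<open>relaxed A\<close> are irrelevant.
\<close>

definition lagrangian_dual ::
    "('k \<Rightarrow> real) set \<Rightarrow> ('x, 'k) min_problem \<Rightarrow> ('k \<Rightarrow> real) max_problem" where
  "lagrangian_dual \<Lambda> A = \<lparr>feasible = \<Lambda>, payoff = dual_function A\<rparr>"

definition nonneg_multipliers :: "('x, 'k) min_problem \<Rightarrow> ('k \<Rightarrow> real) set" where
  "nonneg_multipliers A = {p. \<forall>k\<in>relaxed A. 0 \<le> p k}"

section \<open>Random utility: surplus and perturbation functions\<close>

definition surplus ::
    "'o measure \<Rightarrow> 'i set \<Rightarrow> ('i \<Rightarrow> 'o \<Rightarrow> real) \<Rightarrow> ('i \<Rightarrow> real) \<Rightarrow> real" where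
  "surplus M I \<xi> v = (\<integral>\<omega>. (MIN i\<in>I. v i - \<xi> i \<omega>) \<partial>M)"

text \<open>
  The (concave) conjugate is extended-real valued: it is \<open>-\<infinity>\<close> exactly where the infimum is
  unbounded below, namely outside the probability simplex on \<open>I\<close>.
\<close>

definition perturbation ::
    "'o measure \<Rightarrow> 'i set \<Rightarrow> ('i \<Rightarrow> 'o \<Rightarrow> real) \<Rightarrow> ('i \<Rightarrow> real) \<Rightarrow> ereal" where
  "perturbation M I \<xi> P = (INF v. ereal ((\<Sum>i\<in>I. v i * P i) - surplus M I \<xi> v))"

text \<open>
  Finite means, and a continuous joint distribution, read as continuity of the joint
  distribution function (in the product topology; it depends on the coordinates in \<open>I\<close> only).
  Every law with a density has this property.
\<close>

definition admissible_noise :: "'o measure \<Rightarrow> 'i set \<Rightarrow> ('i \<Rightarrow> 'o \<Rightarrow> real) \<Rightarrow> bool" where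
  "admissible_noise M I \<xi> \<longleftrightarrow>
     (\<forall>i\<in>I. integrable M (\<xi> i)) \<and>
     continuous_on UNIV (\<lambda>x :: 'i \<Rightarrow> real. measure M {\<omega> \<in> space M. \<forall>i\<in>I. \<xi> i \<omega> \<le> x i})"

section \<open>The market\<close>

text \<open>
  A time window is a natural number, \<open>0\<close> being the opt-out; a task bundle is a list of task
  categories, the empty list being the bundle of a driver who performs no task.  The noise
  terms are fields separate from the deterministic costs, so their law does not depend on
  the costs.
\<close>

record ('j, 'w, 'o) market =
  tasks :: "'j set"
  routes :: "'w set"
  horizon :: nat
  max_len :: nat
  num_shippers :: "'j \<Rightarrow> nat"
  num_drivers :: "nat \<times> 'w \<Rightarrow> nat"
  shipper_cost :: "'j \<Rightarrow> nat \<Rightarrow> real"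
  driver_cost :: "nat \<times> 'w \<Rightarrow> 'j list \<Rightarrow> real"
  prob_sp :: "'o measure"
  shipper_noise :: "'j \<Rightarrow> nat \<Rightarrow> 'o \<Rightarrow> real"
  driver_noise :: "nat \<times> 'w \<Rightarrow> 'j list \<Rightarrow> 'o \<Rightarrow> real"

definition windows :: "('j, 'w, 'o) market \<Rightarrow> nat set" where
  "windows m = {1..horizon m}"

definition windows0 :: "('j, 'w, 'o) market \<Rightarrow> nat set" where
  "windows0 m = windows m \<union> {0}"

definition bundles :: "('j, 'w, 'o) market \<Rightarrow> 'j list set" where
  "bundles m = {r. r \<noteq> [] \<and> set r \<subseteq> tasks m \<and> length r \<le> max_len m}"

definition bundles0 :: "('j, 'w, 'o) market \<Rightarrow> 'j list set" where
  "bundles0 m = bundles m \<union> {[]}"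

definition driver_groups :: "('j, 'w, 'o) market \<Rightarrow> (nat \<times> 'w) set" where
  "driver_groups m = windows m \<times> routes m"

definition valid_market :: "('j, 'w, 'o) market \<Rightarrow> bool" where
  "valid_market m \<longleftrightarrow>
     finite (tasks m) \<and> finite (routes m) \<and>
     (\<forall>j\<in>tasks m. 0 < num_shippers m j) \<and>
     (\<forall>g\<in>driver_groups m. 0 < num_drivers m g) \<and>
     prob_space (prob_sp m) \<and>
     (\<forall>j\<in>tasks m. admissible_noise (prob_sp m) (windows0 m) (shipper_noise m j)) \<and>
     (\<forall>g\<in>driver_groups m. admissible_noise (prob_sp m) (bundles0 m) (driver_noise m g))"

definition shipper_surplus :: "('j, 'w, 'o) market \<Rightarrow> 'j \<Rightarrow> (nat \<Rightarrow> real) \<Rightarrow> real" where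
  "shipper_surplus m j = surplus (prob_sp m) (windows0 m) (shipper_noise m j)"

definition driver_surplus ::
    "('j, 'w, 'o) market \<Rightarrow> nat \<times> 'w \<Rightarrow> ('j list \<Rightarrow> real) \<Rightarrow> real" where
  "driver_surplus m g = surplus (prob_sp m) (bundles0 m) (driver_noise m g)"

definition shipper_perturbation :: "('j, 'w, 'o) market \<Rightarrow> 'j \<Rightarrow> (nat \<Rightarrow> real) \<Rightarrow> ereal" where
  "shipper_perturbation m j = perturbation (prob_sp m) (windows0 m) (shipper_noise m j)"

definition driver_perturbation ::
    "('j, 'w, 'o) market \<Rightarrow> nat \<times> 'w \<Rightarrow> ('j list \<Rightarrow> real) \<Rightarrow> ereal" where
  "driver_perturbation m g = perturbation (prob_sp m) (bundles0 m) (driver_noise m g)"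

definition shipper_perturbation_hat ::
    "('j, 'w, 'o) market \<Rightarrow> 'j \<Rightarrow> (nat \<Rightarrow> real) \<Rightarrow> ereal" where
  "shipper_perturbation_hat m j y =
     ereal (real (num_shippers m j)) *
     shipper_perturbation m j (\<lambda>t. y t / real (num_shippers m j))"

definition driver_perturbation_hat ::
    "('j, 'w, 'o) market \<Rightarrow> nat \<times> 'w \<Rightarrow> ('j list \<Rightarrow> real) \<Rightarrow> ereal" where
  "driver_perturbation_hat m g f =
     ereal (real (num_drivers m g)) *
     driver_perturbation m g (\<lambda>r. f r / real (num_drivers m g))"

section \<open>The fluidly approximated master problem and the price problem\<close>

type_synonym ('j, 'w) allocation = "('j \<Rightarrow> nat \<Rightarrow> real) \<times> (nat \<times> 'w \<Rightarrow> 'j list \<Rightarrow> real)"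

definition master_cost :: "('j, 'w, 'o) market \<Rightarrow> ('j, 'w) allocation \<Rightarrow> ereal" where
  "master_cost m = (\<lambda>(y, f).
     (\<Sum>j\<in>tasks m.
        ereal (\<Sum>t\<in>windows0 m. shipper_cost m j t * y j t) - shipper_perturbation_hat m j (y j)) +
     (\<Sum>t\<in>windows m. \<Sum>w\<in>routes m.
        ereal (\<Sum>r\<in>bundles0 m. driver_cost m (t, w) r * f (t, w) r)
          - driver_perturbation_hat m (t, w) (f (t, w))))"

text \<open>
  Nonnegativity of the variables need not be listed among the constraints: the cost of an
  allocation with a negative entry is \<open>\<infinity>\<close>, by the convention for the perturbation functions.
\<close>

definition SO_Master_A ::
    "('j, 'w, 'o) market \<Rightarrow> (('j, 'w) allocation, nat \<times> 'j) min_problem" where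
  "SO_Master_A m =
     \<lparr>ground = {(y, f).
        (\<forall>j\<in>tasks m. (\<Sum>t\<in>windows0 m. y j t) = real (num_shippers m j)) \<and>
        (\<forall>t\<in>windows m. \<forall>w\<in>routes m.
           (\<Sum>r\<in>bundles0 m. f (t, w) r) = real (num_drivers m (t, w)))},
      cost = master_cost m,
      relaxed = windows m \<times> tasks m,
      gap = (\<lambda>(t, j) (y, f).
        y j t - (\<Sum>w\<in>routes m. \<Sum>r\<in>bundles0 m. real (count_list r j) * f (t, w) r))\<rparr>"

definition shipper_price_cost ::
    "('j, 'w, 'o) market \<Rightarrow> (nat \<times> 'j \<Rightarrow> real) \<Rightarrow> 'j \<Rightarrow> nat \<Rightarrow> real" where
  "shipper_price_cost m p j t = shipper_cost m j t + (if t = 0 then 0 else p (t, j))"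

definition driver_price_cost ::
    "('j, 'w, 'o) market \<Rightarrow> (nat \<times> 'j \<Rightarrow> real) \<Rightarrow> nat \<times> 'w \<Rightarrow> 'j list \<Rightarrow> real" where
  "driver_price_cost m p = (\<lambda>(t, w) r.
     driver_cost m (t, w) r - (\<Sum>j\<in>tasks m. real (count_list r j) * p (t, j)))"

definition G :: "('j, 'w, 'o) market \<Rightarrow> (nat \<times> 'j \<Rightarrow> real) \<Rightarrow> real" where
  "G m p =
     (\<Sum>j\<in>tasks m. real (num_shippers m j) * shipper_surplus m j (shipper_price_cost m p j)) +
     (\<Sum>t\<in>windows m. \<Sum>w\<in>routes m.
        real (num_drivers m (t, w)) * driver_surplus m (t, w) (driver_price_cost m p (t, w)))"

definition SO_Master_D :: "('j, 'w, 'o) market \<Rightarrow> (nat \<times> 'j \<Rightarrow> real) max_problem" where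
  "SO_Master_D m = \<lparr>feasible = UNIV, payoff = (\<lambda>p. ereal (G m p))\<rparr>"

end

theory Submission imports Defs begin

text \<open>
  The multipliers enter the Lagrangian only by shifting the deterministic costs: pricing out the
  demand-supply constraints turns \<open>C\<close> into the price-inclusive cost \<open>v\<close> of each agent class, and
  the remaining constraints tie together only the variables of one class.  The dual function
  therefore splits into the problems
  of minimising \<open>v \<bullet> y - N * H (y / N)\<close> over all \<open>y\<close> with entries summing to \<open>N\<close>, one for each
  class, where \<open>H\<close> is the concave conjugate of the surplus \<open>\<Pi>\<close>.  The claim is that each of these has
  minimum \<open>N * \<Pi> v\<close>, which is the biconjugation identity for \<open>\<Pi>\<close>, with the infimum restricted to
  vectors of total mass one.

  The bound \<open>H P \<le> v \<bullet> P - \<Pi> v\<close> is the definition of the conjugate.  Equality comes from an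
  explicit supergradient of \<open>\<Pi>\<close> at \<open>v\<close>: the vector \<open>P\<close> of choice probabilities when every
  agent takes a cheapest alternative, ties being broken uniformly.  Someone who faces costs \<open>u\<close> but
  keeps choosing as if they were \<open>v\<close> pays at least the minimum, so
  \<open>\<Pi> u \<le> \<Pi> v + P \<bullet> (u - v)\<close>; these \<open>P\<close> sum to one (lemma \<open>surplus_supergradient\<close>).
  Since \<open>H < \<infinity>\<close> everywhere, an infinite value of \<open>H\<close> makes the Lagrangian \<open>\<infinity>\<close>, so the lower bound
  survives in the extended reals, and at the minimiser everything is finite.  The dual function thus
  agrees with \<open>G\<close> at prices of either sign, which settles both multiplier sets at once.
\<close>

section \<open>The surplus function and its supergradients\<close>

lemma borel_measurable_Min_diff:
  fixes \<xi> :: "'i \<Rightarrow> 'o \<Rightarrow> real"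
  assumes "finite I" "I \<noteq> {}" "\<And>i. i \<in> I \<Longrightarrow> \<xi> i \<in> borel_measurable M"
  shows "(\<lambda>\<omega>. MIN i\<in>I. v i - \<xi> i \<omega>) \<in> borel_measurable M"
proof -
  have "(\<lambda>\<omega>. INF i\<in>I. v i - \<xi> i \<omega>) \<in> borel_measurable M"
    using assms by (intro borel_measurable_cINF_real) (auto simp: countable_finite)
  then show ?thesis
    using assms by (simp add: cInf_eq_Min)
qed

lemma integrable_Min_diff:
  fixes \<xi> :: "'i \<Rightarrow> 'o \<Rightarrow> real"
  assumes "prob_space M" "finite I" "I \<noteq> {}" and int: "\<And>i. i \<in> I \<Longrightarrow> integrable M (\<xi> i)"
  shows "integrable M (\<lambda>\<omega>. MIN i\<in>I. v i - \<xi> i \<omega>)"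
proof (rule Bochner_Integration.integrable_bound)
  interpret prob_space M by fact
  show "integrable M (\<lambda>\<omega>. \<Sum>i\<in>I. \<bar>v i - \<xi> i \<omega>\<bar>)"
    using int by (intro Bochner_Integration.integrable_sum integrable_abs
        Bochner_Integration.integrable_diff) auto
  show "(\<lambda>\<omega>. MIN i\<in>I. v i - \<xi> i \<omega>) \<in> borel_measurable M"
    using assms by (intro borel_measurable_Min_diff) auto
  show "AE \<omega> in M. norm (MIN i\<in>I. v i - \<xi> i \<omega>) \<le> norm (\<Sum>i\<in>I. \<bar>v i - \<xi> i \<omega>\<bar>)"
  proof (rule AE_I2)
    fix \<omega>
    have "(MIN i\<in>I. v i - \<xi> i \<omega>) \<in> (\<lambda>i. v i - \<xi> i \<omega>) ` I"
      using assms by (intro Min_in) auto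
    then obtain i where i: "i \<in> I" "(MIN i\<in>I. v i - \<xi> i \<omega>) = v i - \<xi> i \<omega>" by auto
    have "\<bar>v i - \<xi> i \<omega>\<bar> \<le> (\<Sum>i\<in>I. \<bar>v i - \<xi> i \<omega>\<bar>)"
      using assms(2) i(1) by (intro member_le_sum) auto
    then show "norm (MIN i\<in>I. v i - \<xi> i \<omega>) \<le> norm (\<Sum>i\<in>I. \<bar>v i - \<xi> i \<omega>\<bar>)"
      by (simp add: i(2))
  qed
qed

text \<open>
  Uniform tie-breaking makes a measurable selection of a minimiser unnecessary: at every outcome
  the weight is spread evenly over all minimisers, and the weights are visibly measurable.
\<close>

definition tie_weight :: "'i set \<Rightarrow> ('i \<Rightarrow> real) \<Rightarrow> 'i \<Rightarrow> real" where
  "tie_weight I c i =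
     (if c i = Min (c ` I) then 1 else 0) / (\<Sum>k\<in>I. if c k = Min (c ` I) then 1 else 0)"

lemma tie_weight_nonneg: "0 \<le> tie_weight I c i"
  by (auto simp: tie_weight_def intro!: divide_nonneg_nonneg sum_nonneg)

lemma sum_tie_weight:
  assumes "finite I" "I \<noteq> {}"
  shows "(\<Sum>i\<in>I. tie_weight I c i) = 1"
proof -
  have "Min (c ` I) \<in> c ` I" using assms by (intro Min_in) auto
  then obtain i where "i \<in> I" "c i = Min (c ` I)" by auto
  then have "(\<Sum>k\<in>I. if c k = Min (c ` I) then 1 else 0) > (0::real)"
    using assms by (intro sum_pos2[of I i]) auto
  then show ?thesis
    by (simp add: tie_weight_def flip: sum_divide_distrib)
qed

lemma tie_weight_le_1:
  assumes "finite I" "i \<in> I"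
  shows "tie_weight I c i \<le> 1"
proof -
  have "tie_weight I c i \<le> (\<Sum>i\<in>I. tie_weight I c i)"
    using assms by (intro member_le_sum) (auto simp: tie_weight_nonneg)
  also have "\<dots> = 1" using assms by (intro sum_tie_weight) auto
  finally show ?thesis .
qed

lemma sum_tie_weight_mult:
  assumes "finite I" "I \<noteq> {}"
  shows "(\<Sum>i\<in>I. tie_weight I c i * c i) = Min (c ` I)"
proof -
  have "(\<Sum>i\<in>I. tie_weight I c i * c i) = (\<Sum>i\<in>I. tie_weight I c i * Min (c ` I))"
    by (intro sum.cong) (auto simp: tie_weight_def)
  also have "\<dots> = Min (c ` I)"
    using sum_tie_weight[OF assms, of c] by (simp flip: sum_distrib_right)
  finally show ?thesis .
qed

lemma Min_le_sum_tie_weight_mult: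
  assumes "finite I" "I \<noteq> {}"
  shows "Min (d ` I) \<le> (\<Sum>i\<in>I. tie_weight I c i * d i)"
proof -
  have "Min (d ` I) = (\<Sum>i\<in>I. tie_weight I c i * Min (d ` I))"
    using sum_tie_weight[OF assms, of c] by (simp flip: sum_distrib_right)
  also have "\<dots> \<le> (\<Sum>i\<in>I. tie_weight I c i * d i)"
    using assms by (intro sum_mono mult_left_mono) (auto simp: tie_weight_nonneg)
  finally show ?thesis .
qed

text \<open>
  Integrating the tie-breaking weights at \<open>v\<close> gives the choice probabilities.  The cost of following
  this choice rule under \<open>u\<close> is affine in \<open>u\<close> with slope \<open>P\<close>, dominates the surplus, and
  touches it at \<open>v\<close>.
\<close>

lemma surplus_supergradient:
  fixes \<xi> :: "'i \<Rightarrow> 'o \<Rightarrow> real"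
  assumes ps: "prob_space M" and I: "finite I" "I \<noteq> {}"
    and int: "\<And>i. i \<in> I \<Longrightarrow> integrable M (\<xi> i)"
  obtains P :: "'i \<Rightarrow> real" where "(\<Sum>i\<in>I. P i) = 1"
    and "\<And>u. surplus M I \<xi> u \<le> surplus M I \<xi> v + (\<Sum>i\<in>I. (u i - v i) * P i)"
proof -
  interpret prob_space M by fact
  define W where "W \<omega> = tie_weight I (\<lambda>i. v i - \<xi> i \<omega>)" for \<omega>
  have meas [measurable]: "\<xi> i \<in> borel_measurable M" if "i \<in> I" for i
    using int[OF that] by auto
  have Min_meas [measurable]: "(\<lambda>\<omega>. MIN i\<in>I. v i - \<xi> i \<omega>) \<in> borel_measurable M"
    using I meas by (rule borel_measurable_Min_diff)
  have ind [measurable]: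
    "(\<lambda>\<omega>. if v k - \<xi> k \<omega> = (MIN i\<in>I. v i - \<xi> i \<omega>) then 1 else 0 :: real) \<in> borel_measurable M"
    if "k \<in> I" for k
    using that by measurable
  have W_meas [measurable]: "(\<lambda>\<omega>. W \<omega> i) \<in> borel_measurable M" if "i \<in> I" for i
    unfolding W_def tie_weight_def using that
    by (intro borel_measurable_divide borel_measurable_sum ind)
  have W_le: "norm (W \<omega> i) \<le> 1" if "i \<in> I" for \<omega> i
    using that I by (simp add: W_def tie_weight_nonneg tie_weight_le_1)
  have W_int: "integrable M (\<lambda>\<omega>. W \<omega> i)" if "i \<in> I" for i
    using that W_le by (intro integrable_const_bound[where B = 1]) auto
  have W\<xi>_int: "integrable M (\<lambda>\<omega>. W \<omega> i * \<xi> i \<omega>)" if "i \<in> I" for i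
  proof (rule Bochner_Integration.integrable_bound[OF int[OF that]])
    show "AE \<omega> in M. norm (W \<omega> i * \<xi> i \<omega>) \<le> norm (\<xi> i \<omega>)"
      using W_le[OF that] by (intro AE_I2) (simp add: abs_mult mult_left_le_one_le)
  qed (use that in measurable)
  define P where "P i = (\<integral>\<omega>. W \<omega> i \<partial>M)" for i
  define k where "k = (\<Sum>i\<in>I. \<integral>\<omega>. W \<omega> i * \<xi> i \<omega> \<partial>M)"
  have W_eq: "(\<lambda>\<omega>. \<Sum>i\<in>I. W \<omega> i * (u i - \<xi> i \<omega>)) =
      (\<lambda>\<omega>. (\<Sum>i\<in>I. u i * W \<omega> i) - (\<Sum>i\<in>I. W \<omega> i * \<xi> i \<omega>))" for u
    by (simp add: algebra_simps sum_subtractf)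
  have rule_int: "integrable M (\<lambda>\<omega>. \<Sum>i\<in>I. W \<omega> i * (u i - \<xi> i \<omega>))" for u
    unfolding W_eq using W_int W\<xi>_int
    by (intro Bochner_Integration.integrable_diff Bochner_Integration.integrable_sum
        integrable_mult_right) auto
  have rule_cost: "(\<integral>\<omega>. (\<Sum>i\<in>I. W \<omega> i * (u i - \<xi> i \<omega>)) \<partial>M) = (\<Sum>i\<in>I. u i * P i) - k" for u
    unfolding W_eq P_def k_def using W_int W\<xi>_int
    by (subst Bochner_Integration.integral_diff)
      (auto simp: Bochner_Integration.integral_sum intro!: Bochner_Integration.integrable_sum)
  have at_v: "surplus M I \<xi> v = (\<Sum>i\<in>I. v i * P i) - k"
    unfolding surplus_def rule_cost[symmetric] W_def
    using I by (simp add: sum_tie_weight_mult)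
  have above: "surplus M I \<xi> u \<le> (\<Sum>i\<in>I. u i * P i) - k" for u
    unfolding surplus_def rule_cost[symmetric]
  proof (rule integral_mono)
    show "integrable M (\<lambda>\<omega>. MIN i\<in>I. u i - \<xi> i \<omega>)"
      using ps I int by (rule integrable_Min_diff)
    show "(MIN i\<in>I. u i - \<xi> i \<omega>) \<le> (\<Sum>i\<in>I. W \<omega> i * (u i - \<xi> i \<omega>))" for \<omega>
      unfolding W_def using I by (rule Min_le_sum_tie_weight_mult)
  qed (rule rule_int)
  show thesis
  proof
    have "(\<Sum>i\<in>I. P i) = (\<integral>\<omega>. (\<Sum>i\<in>I. W \<omega> i) \<partial>M)"
      unfolding P_def using W_int by (subst Bochner_Integration.integral_sum) auto
    also have "\<dots> = 1"
      using I by (simp add: W_def sum_tie_weight prob_space)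
    finally show "(\<Sum>i\<in>I. P i) = 1" .
    show "surplus M I \<xi> u \<le> surplus M I \<xi> v + (\<Sum>i\<in>I. (u i - v i) * P i)" for u
      using above[of u] by (simp add: at_v left_diff_distrib sum_subtractf)
  qed
qed

section \<open>The subproblem of one agent class\<close>

lemma perturbation_le: "perturbation M I \<xi> P \<le> ereal ((\<Sum>i\<in>I. v i * P i) - surplus M I \<xi> v)"
  unfolding perturbation_def by (rule INF_lower) simp

text \<open>
  This is the defining inequality of the conjugate at \<open>v\<close>, scaled by \<open>N\<close>.  The payment
  \<open>(v - C) \<bullet> y\<close> is kept with the surplus, so that one side is a plain real number and the other is
  exactly the contribution of the class to the cost of the program.
\<close>

lemma class_cost_ge:
  assumes "0 < N"
  shows "ereal (N * surplus M I \<xi> v - (\<Sum>i\<in>I. (v i - C i) * y i))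
    \<le> ereal (\<Sum>i\<in>I. C i * y i) - ereal N * perturbation M I \<xi> (\<lambda>i. y i / N)"
proof -
  have "ereal N * perturbation M I \<xi> (\<lambda>i. y i / N)
      \<le> ereal N * ereal ((\<Sum>i\<in>I. v i * (y i / N)) - surplus M I \<xi> v)"
    using assms by (intro ereal_mult_left_mono perturbation_le) auto
  also have "\<dots> = ereal ((\<Sum>i\<in>I. v i * y i) - N * surplus M I \<xi> v)"
    using assms by (simp add: algebra_simps flip: sum_divide_distrib)
  finally have "ereal (\<Sum>i\<in>I. C i * y i) - ereal ((\<Sum>i\<in>I. v i * y i) - N * surplus M I \<xi> v)
      \<le> ereal (\<Sum>i\<in>I. C i * y i) - ereal N * perturbation M I \<xi> (\<lambda>i. y i / N)"
    by (intro ereal_minus_mono) auto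
  then show ?thesis
    by (simp add: left_diff_distrib sum_subtractf algebra_simps)
qed

text \<open>
  At a supergradient \<open>P\<close> of the surplus the conjugate is attained at \<open>v\<close>, so scaling \<open>P\<close> to mass
  \<open>N\<close> makes the preceding bound tight.
\<close>

lemma class_cost_attained:
  assumes "prob_space M" "finite I" "I \<noteq> {}" "admissible_noise M I \<xi>" and N: "0 < N"
  shows "\<exists>y. (\<Sum>i\<in>I. y i) = N \<and>
    ereal (\<Sum>i\<in>I. C i * y i) - ereal N * perturbation M I \<xi> (\<lambda>i. y i / N)
      = ereal (N * surplus M I \<xi> v - (\<Sum>i\<in>I. (v i - C i) * y i))"
proof -
  have "\<And>i. i \<in> I \<Longrightarrow> integrable M (\<xi> i)"
    using assms(4) by (simp add: admissible_noise_def)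
  then obtain P where P: "(\<Sum>i\<in>I. P i) = 1"
    "\<And>u. surplus M I \<xi> u \<le> surplus M I \<xi> v + (\<Sum>i\<in>I. (u i - v i) * P i)"
    using surplus_supergradient[OF assms(1-3)] by metis
  have "perturbation M I \<xi> P = ereal ((\<Sum>i\<in>I. v i * P i) - surplus M I \<xi> v)"
  proof (rule antisym[OF perturbation_le])
    show "ereal ((\<Sum>i\<in>I. v i * P i) - surplus M I \<xi> v) \<le> perturbation M I \<xi> P"
      unfolding perturbation_def
    proof (rule INF_greatest)
      fix u
      show "ereal ((\<Sum>i\<in>I. v i * P i) - surplus M I \<xi> v)
          \<le> ereal ((\<Sum>i\<in>I. u i * P i) - surplus M I \<xi> u)"
        using P(2)[of u] by (simp add: left_diff_distrib sum_subtractf)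
    qed
  qed
  then have "ereal (\<Sum>i\<in>I. C i * (N * P i)) - ereal N * perturbation M I \<xi> (\<lambda>i. N * P i / N)
      = ereal (N * surplus M I \<xi> v - (\<Sum>i\<in>I. (v i - C i) * (N * P i)))"
    using N by (simp add: left_diff_distrib sum_subtractf algebra_simps sum_distrib_left)
  moreover have "(\<Sum>i\<in>I. N * P i) = N"
    using P(1) by (simp flip: sum_distrib_left)
  ultimately show ?thesis by blast
qed

section \<open>The dual function of the master problem\<close>

lemma finite_windows [simp]: "finite (windows m)" "finite (windows0 m)"
  by (auto simp: windows_def windows0_def)

lemma finite_bundles0:
  assumes "finite (tasks m)"
  shows "finite (bundles0 m)"
proof -
  have "bundles m \<subseteq> {r. set r \<subseteq> tasks m \<and> length r \<le> max_len m}"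
    by (auto simp: bundles_def)
  then show ?thesis
    using finite_lists_length_le[OF assms] by (auto simp: bundles0_def intro: finite_subset)
qed

text \<open>
  The lower bounds for the single classes, added up: the total surplus at prices \<open>p\<close> less the
  payments that the allocation would entail.  It is affine in the allocation.
\<close>

definition priced_cost ::
    "('j, 'w, 'o) market \<Rightarrow> (nat \<times> 'j \<Rightarrow> real) \<Rightarrow> ('j, 'w) allocation \<Rightarrow> real" where
  "priced_cost m p = (\<lambda>(y, f).
     (\<Sum>j\<in>tasks m. real (num_shippers m j) * shipper_surplus m j (shipper_price_cost m p j)
        - (\<Sum>t\<in>windows0 m. (shipper_price_cost m p j t - shipper_cost m j t) * y j t)) +
     (\<Sum>t\<in>windows m. \<Sum>w\<in>routes m.
        real (num_drivers m (t, w)) * driver_surplus m (t, w) (driver_price_cost m p (t, w))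
          - (\<Sum>r\<in>bundles0 m. (driver_price_cost m p (t, w) r - driver_cost m (t, w) r)
               * f (t, w) r)))"

text \<open>
  What the shippers pay minus what the drivers receive is exactly the multiplier term, after
  exchanging the order of summation; so the dependence on the allocation cancels.
\<close>

lemma priced_cost_plus_gaps:
  assumes "finite (tasks m)" "finite (routes m)"
  shows "priced_cost m p x + (\<Sum>k\<in>relaxed (SO_Master_A m). p k * gap (SO_Master_A m) k x) = G m p"
proof -
  obtain y f where x: "x = (y, f)" by (cases x)
  define S where "S t j = (\<Sum>w\<in>routes m. \<Sum>r\<in>bundles0 m. real (count_list r j) * f (t, w) r)" for t j
  have shippers: "(\<Sum>t\<in>windows0 m. (shipper_price_cost m p j t - shipper_cost m j t) * y j t)
      = (\<Sum>t\<in>windows m. p (t, j) * y j t)" for j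
  proof -
    have "windows0 m = insert 0 (windows m)" "0 \<notin> windows m"
      by (auto simp: windows0_def windows_def)
    then have "(\<Sum>t\<in>windows0 m. (shipper_price_cost m p j t - shipper_cost m j t) * y j t)
        = (\<Sum>t\<in>windows m. (shipper_price_cost m p j t - shipper_cost m j t) * y j t)"
      by (simp add: shipper_price_cost_def)
    also have "\<dots> = (\<Sum>t\<in>windows m. p (t, j) * y j t)"
      using \<open>0 \<notin> windows m\<close> by (intro sum.cong) (auto simp: shipper_price_cost_def)
    finally show ?thesis .
  qed
  have drivers: "(\<Sum>w\<in>routes m. \<Sum>r\<in>bundles0 m.
        (driver_price_cost m p (t, w) r - driver_cost m (t, w) r) * f (t, w) r)
      = - (\<Sum>j\<in>tasks m. p (t, j) * S t j)" for t
  proof -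
    have "(\<Sum>w\<in>routes m. \<Sum>r\<in>bundles0 m.
        (driver_price_cost m p (t, w) r - driver_cost m (t, w) r) * f (t, w) r)
      = - (\<Sum>w\<in>routes m. \<Sum>r\<in>bundles0 m. \<Sum>j\<in>tasks m.
            p (t, j) * (real (count_list r j) * f (t, w) r))"
      by (simp add: driver_price_cost_def sum_distrib_left sum_negf algebra_simps)
    also have "(\<Sum>w\<in>routes m. \<Sum>r\<in>bundles0 m. \<Sum>j\<in>tasks m.
            p (t, j) * (real (count_list r j) * f (t, w) r))
      = (\<Sum>w\<in>routes m. \<Sum>j\<in>tasks m. \<Sum>r\<in>bundles0 m.
            p (t, j) * (real (count_list r j) * f (t, w) r))"
      by (intro sum.cong refl sum.swap)
    also have "\<dots> = (\<Sum>j\<in>tasks m. \<Sum>w\<in>routes m. \<Sum>r\<in>bundles0 m.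
            p (t, j) * (real (count_list r j) * f (t, w) r))"
      by (rule sum.swap)
    also have "\<dots> = (\<Sum>j\<in>tasks m. p (t, j) * S t j)"
      by (simp add: S_def sum_distrib_left)
    finally show ?thesis .
  qed
  have "(\<Sum>k\<in>relaxed (SO_Master_A m). p k * gap (SO_Master_A m) k x)
      = (\<Sum>t\<in>windows m. \<Sum>j\<in>tasks m. p (t, j) * (y j t - S t j))"
    by (simp add: SO_Master_A_def x S_def sum.cartesian_product case_prod_beta)
  also have "\<dots> = (\<Sum>j\<in>tasks m. \<Sum>t\<in>windows m. p (t, j) * y j t)
      - (\<Sum>t\<in>windows m. \<Sum>j\<in>tasks m. p (t, j) * S t j)"
    unfolding sum.swap[of "\<lambda>j t. p (t, j) * y j t" "windows m" "tasks m"]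
    by (simp add: right_diff_distrib sum_subtractf)
  finally show ?thesis
    by (simp add: priced_cost_def x G_def sum_subtractf shippers drivers sum_negf)
qed

lemma ereal_sum_le_sum:
  assumes "\<And>i. i \<in> A \<Longrightarrow> ereal (a i) \<le> b i"
  shows "ereal (\<Sum>i\<in>A. a i) \<le> (\<Sum>i\<in>A. b i)"
  unfolding sum_ereal[symmetric] using assms by (rule sum_mono)

lemma priced_cost_le:
  assumes "valid_market m"
  shows "ereal (priced_cost m p x) \<le> master_cost m x"
proof -
  obtain y f where x: "x = (y, f)" by (cases x)
  have pos: "\<And>j. j \<in> tasks m \<Longrightarrow> 0 < real (num_shippers m j)"
    "\<And>t w. t \<in> windows m \<Longrightarrow> w \<in> routes m \<Longrightarrow> 0 < real (num_drivers m (t, w))"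
    using assms by (auto simp: valid_market_def driver_groups_def)
  show ?thesis
    unfolding x priced_cost_def master_cost_def case_prod_conv plus_ereal.simps(1)[symmetric]
      shipper_surplus_def driver_surplus_def shipper_perturbation_hat_def
      driver_perturbation_hat_def shipper_perturbation_def driver_perturbation_def
    by (intro add_mono ereal_sum_le_sum class_cost_ge pos)
qed

text \<open>
  The minimisers of the classes can be chosen independently, because no kept constraint links two
  of them.
\<close>

lemma priced_cost_attained:
  assumes "valid_market m"
  shows "\<exists>x \<in> ground (SO_Master_A m). master_cost m x = ereal (priced_cost m p x)"
proof -
  have ps: "prob_space (prob_sp m)" and fin: "finite (bundles0 m)"
    using assms by (auto simp: valid_market_def intro: finite_bundles0)
  have "\<forall>j\<in>tasks m. \<exists>y. (\<Sum>t\<in>windows0 m. y t) = real (num_shippers m j) \<and>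
      ereal (\<Sum>t\<in>windows0 m. shipper_cost m j t * y t) - shipper_perturbation_hat m j y
      = ereal (real (num_shippers m j) * shipper_surplus m j (shipper_price_cost m p j)
          - (\<Sum>t\<in>windows0 m. (shipper_price_cost m p j t - shipper_cost m j t) * y t))"
    unfolding shipper_perturbation_hat_def shipper_perturbation_def shipper_surplus_def
    using assms by (intro ballI class_cost_attained ps) (auto simp: valid_market_def windows0_def)
  from bchoice[OF this] obtain y where
    y: "\<And>j. j \<in> tasks m \<Longrightarrow> (\<Sum>t\<in>windows0 m. y j t) = real (num_shippers m j)"
    and y_cost: "\<And>j. j \<in> tasks m \<Longrightarrow>
      ereal (\<Sum>t\<in>windows0 m. shipper_cost m j t * y j t) - shipper_perturbation_hat m j (y j)
      = ereal (real (num_shippers m j) * shipper_surplus m j (shipper_price_cost m p j)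
          - (\<Sum>t\<in>windows0 m. (shipper_price_cost m p j t - shipper_cost m j t) * y j t))"
    by blast
  have "\<forall>g\<in>driver_groups m. \<exists>f. (\<Sum>r\<in>bundles0 m. f r) = real (num_drivers m g) \<and>
      ereal (\<Sum>r\<in>bundles0 m. driver_cost m g r * f r) - driver_perturbation_hat m g f
      = ereal (real (num_drivers m g) * driver_surplus m g (driver_price_cost m p g)
          - (\<Sum>r\<in>bundles0 m. (driver_price_cost m p g r - driver_cost m g r) * f r))"
    unfolding driver_perturbation_hat_def driver_perturbation_def driver_surplus_def
    using assms by (intro ballI class_cost_attained ps fin) (auto simp: valid_market_def bundles0_def)
  from bchoice[OF this] obtain f where
    f: "\<And>g. g \<in> driver_groups m \<Longrightarrow> (\<Sum>r\<in>bundles0 m. f g r) = real (num_drivers m g)"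
    and f_cost: "\<And>g. g \<in> driver_groups m \<Longrightarrow>
      ereal (\<Sum>r\<in>bundles0 m. driver_cost m g r * f g r) - driver_perturbation_hat m g (f g)
      = ereal (real (num_drivers m g) * driver_surplus m g (driver_price_cost m p g)
          - (\<Sum>r\<in>bundles0 m. (driver_price_cost m p g r - driver_cost m g r) * f g r))"
    by blast
  have "(y, f) \<in> ground (SO_Master_A m)"
    using y f by (auto simp: SO_Master_A_def driver_groups_def)
  moreover have "master_cost m (y, f) = ereal (priced_cost m p (y, f))"
    unfolding master_cost_def priced_cost_def case_prod_conv
    by (simp add: y_cost f_cost driver_groups_def cong: sum.cong)
  ultimately show ?thesis by blast
qed

lemma dual_function_SO_Master_A:
  assumes "valid_market m"
  shows "dual_function (SO_Master_A m) p = ereal (G m p)"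
proof (rule antisym)
  define L where "L x = (\<Sum>k\<in>relaxed (SO_Master_A m). p k * gap (SO_Master_A m) k x)" for x
  have lag: "lagrangian (SO_Master_A m) x p = master_cost m x + ereal (L x)" for x
    by (simp add: lagrangian_def L_def SO_Master_A_def)
  have G: "ereal (priced_cost m p x) + ereal (L x) = ereal (G m p)" for x
    using assms priced_cost_plus_gaps[of m p x] by (simp add: L_def valid_market_def)
  show "dual_function (SO_Master_A m) p \<le> ereal (G m p)"
  proof -
    obtain x where "x \<in> ground (SO_Master_A m)" "master_cost m x = ereal (priced_cost m p x)"
      using priced_cost_attained[OF assms] by blast
    then show ?thesis
      unfolding dual_function_def using G[of x] by (auto simp: lag intro!: INF_lower2)
  qed
  show "ereal (G m p) \<le> dual_function (SO_Master_A m) p"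
    unfolding dual_function_def
  proof (rule INF_greatest)
    fix x
    show "ereal (G m p) \<le> lagrangian (SO_Master_A m) x p"
      unfolding lag G[of x, symmetric] by (intro add_right_mono priced_cost_le assms)
  qed
qed

theorem proposition3p3:
  fixes m :: "('j, 'w, 'o) market"
  assumes "valid_market m"
  shows "lagrangian_dual UNIV (SO_Master_A m) = SO_Master_D m \<and>
    lagrangian_dual (nonneg_multipliers (SO_Master_A m)) (SO_Master_A m) =
      SO_Master_D m \<lparr>feasible := {p. \<forall>t\<in>windows m. \<forall>j\<in>tasks m. 0 \<le> p (t, j)}\<rparr>"
proof -
  have "dual_function (SO_Master_A m) = (\<lambda>p. ereal (G m p))"
    by (rule ext) (rule dual_function_SO_Master_A[OF assms])
  moreover have "nonneg_multipliers (SO_Master_A m)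
      = {p. \<forall>t\<in>windows m. \<forall>j\<in>tasks m. 0 \<le> p (t, j)}"
    by (auto simp: nonneg_multipliers_def SO_Master_A_def)
  ultimately show ?thesis
    by (simp add: lagrangian_dual_def SO_Master_D_def)
qed

end
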